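(* Let $S$ be a semiring, $M$ an arbitrary $S$-semimodule and $G$ a cancellative torsion-free commutative monoid. If $f\in S[G]$ is a zero-divisor on the $S[G]$-semimodule $M[G]$ (i.e. $f\cdot g=0$ for some nonzero $g\in M[G]$), then $f$ can be annihilated by a nonzero constant of $M$: there is a nonzero $b\in M$ such that $f\cdot b=0$ in $M[G]$.
   Context: A semiring is a set $S$ with operations $+,\cdot$ such that $(S,+)$ is a commutative monoid with identity $0$, $(S,\cdot)$ is a commutative monoid with identity $1\neq 0$, multiplication distributes over addition, and $s\cdot 0=0$ for all $s\in S$. An $S$-semimodule is a commutative monoid $(M,+,0)$ with a scalar multiplication $S\times M\to M$ satisfying the usual module axioms together with $0_S\cdot m=0_M=s\cdot 0_M$ and $1\cdot m=m$. A commutative monoid $G$ (written additively) is cancellative if $a+b=a+c$ implies $b=c$, and torsion-free if $na=nb$ with $n\geq 1$ implies $a=b$. $S[G]$ is the monoid semiring (finite formal sums $\sum s_iX^{g_i}$, $s_i\in S$, $g_i\in G$, with $X^gX^h=X^{g+h}$), and $M[G]$ is the analogous set of finite formal sums $\sum m_iX^{g_i}$, $m_i\in M$, an $S[G]$-semimodule via $(sX^g)(mX^h)=(sm)X^{g+h}$. An element $m\in M$ is identified with the constant $mX^0\in M[G]$. *)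

theory Defs
  imports "HOL-Library.Poly_Mapping"
begin

text \<open>Semirings in the present sense (commutative, with \<open>0 \<noteq> 1\<close>) are the types of class
  \<^class>\<open>comm_semiring_1\<close>. The library's modules require additive inverses,
  hence the following.\<close>

locale semimodule =
  fixes scale :: "'s::comm_semiring_1 \<Rightarrow> 'm::comm_monoid_add \<Rightarrow> 'm"
  assumes scale_add_right: "scale s (m + n) = scale s m + scale s n"
    and scale_add_left: "scale (s + t) m = scale s m + scale t m"
    and scale_scale: "scale (s * t) m = scale s (scale t m)"
    and scale_one: "scale 1 m = m"
    and scale_zero_left: "scale 0 m = 0"
    and scale_zero_right: "scale s 0 = 0"

definition zero_divisor_on ::
  "('s::comm_semiring_1 \<Rightarrow> 'm::comm_monoid_add \<Rightarrow> 'm) \<Rightarrow> 's \<Rightarrow> bool" where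
  "zero_divisor_on scale s \<longleftrightarrow> (\<exists>m. m \<noteq> 0 \<and> scale s m = 0)"

text \<open>Cancellativity is the library class \<^class>\<open>cancel_semigroup_add\<close>; the class
  \<^class>\<open>cancel_comm_monoid_add\<close> is avoided because it also postulates a total subtraction
  with laws that do not follow from cancellativity. The multiple \<open>n a\<close> is written as the
  \<open>n\<close>-fold sum of \<open>a\<close>.\<close>

class torsion_free_comm_monoid_add = comm_monoid_add +
  assumes torsion_free: "(n::nat) \<ge> 1 \<Longrightarrow> (\<Sum>i<n. a) = (\<Sum>i<n. b) \<Longrightarrow> a = b"

text \<open>The monoid semiring \<open>S[G]\<close> is \<^typ>\<open>'g \<Rightarrow>\<^sub>0 's\<close> with the library's convolution product,
  \<open>M[G]\<close> is \<^typ>\<open>'g \<Rightarrow>\<^sub>0 'm\<close>, and \<open>m X\<^sup>g\<close> is \<^term>\<open>Poly_Mapping.single g m\<close>. The action is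
  the biadditive extension of \<open>(s X\<^sup>g) (m X\<^sup>h) = (s m) X\<^bsup>g + h\<^esup>\<close>.\<close>

definition monoid_scale ::
  "('s::comm_semiring_1 \<Rightarrow> 'm::comm_monoid_add \<Rightarrow> 'm) \<Rightarrow>
    ('g::comm_monoid_add \<Rightarrow>\<^sub>0 's) \<Rightarrow> ('g \<Rightarrow>\<^sub>0 'm) \<Rightarrow> ('g \<Rightarrow>\<^sub>0 'm)" where
  "monoid_scale scale f p =
    (\<Sum>g\<in>Poly_Mapping.keys f. \<Sum>h\<in>Poly_Mapping.keys p.
      Poly_Mapping.single (g + h)
        (scale (Poly_Mapping.lookup f g) (Poly_Mapping.lookup p h)))"

definition const_poly :: "'m::zero \<Rightarrow> ('g::zero \<Rightarrow>\<^sub>0 'm)" where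
  "const_poly m = Poly_Mapping.single 0 m"

lemma poly_mapping_single_induct [case_names zero add]:
  fixes p :: "'g \<Rightarrow>\<^sub>0 'm::comm_monoid_add"
  assumes "P 0" and step: "\<And>g m q. P q \<Longrightarrow> P (Poly_Mapping.single g m + q)"
  shows "P p"
proof -
  have "P (\<Sum>g\<in>A. Poly_Mapping.single g (Poly_Mapping.lookup p g))" if "finite A" for A
    using that by (induction A) (simp_all add: assms)
  moreover have "(\<Sum>g\<in>Poly_Mapping.keys p. Poly_Mapping.single g (Poly_Mapping.lookup p g)) = p"
    by (rule poly_mapping_eqI)
      (auto simp: lookup_sum lookup_single when_def in_keys_iff sum.delta)
  ultimately show ?thesis by (metis finite_keys)
qed

context semimodule
begin

lemma monoid_scale_single [simp]:
  "monoid_scale scale (Poly_Mapping.single g s) (Poly_Mapping.single h m) =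
    Poly_Mapping.single (g + h) (scale s m)"
  by (simp add: monoid_scale_def scale_zero_left scale_zero_right)

lemma monoid_scale_zero [simp]:
  "monoid_scale scale 0 p = 0" "monoid_scale scale f 0 = 0"
  by (simp_all add: monoid_scale_def)

lemma monoid_scale_add_left:
  "monoid_scale scale (f + f') p = monoid_scale scale f p + monoid_scale scale f' p"
  unfolding monoid_scale_def
  by (subst setsum_keys_plus_distrib[where f = "\<lambda>g s. \<Sum>h\<in>Poly_Mapping.keys p.
      Poly_Mapping.single (g + h) (scale s (Poly_Mapping.lookup p h))"])
    (simp_all add: scale_zero_left scale_add_left single_add sum.distrib)

lemma monoid_scale_add_right:
  "monoid_scale scale f (p + p') = monoid_scale scale f p + monoid_scale scale f p'"
  unfolding monoid_scale_def sum.distrib[symmetric]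
  by (rule sum.cong[OF refl], rule setsum_keys_plus_distrib)
    (simp_all add: scale_zero_right scale_add_right single_add)

lemma monoid_scale_mult:
  "monoid_scale scale (f * f') p = monoid_scale scale f (monoid_scale scale f' p)"
proof (induction p rule: poly_mapping_single_induct)
  case (add k m p)
  have "monoid_scale scale (Poly_Mapping.single g s * f') (Poly_Mapping.single k m) =
    monoid_scale scale (Poly_Mapping.single g s)
      (monoid_scale scale f' (Poly_Mapping.single k m))" for g s
    by (induction f' rule: poly_mapping_single_induct)
      (simp_all add: distrib_left monoid_scale_add_left monoid_scale_add_right mult_single
        scale_scale add.assoc)
  then have "monoid_scale scale (f * f') (Poly_Mapping.single k m) =
    monoid_scale scale f (monoid_scale scale f' (Poly_Mapping.single k m))"
    by (induction f rule: poly_mapping_single_induct)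
      (simp_all add: distrib_right monoid_scale_add_left)
  with add.IH show ?case by (simp add: monoid_scale_add_right)
qed simp

lemma monoid_scale_one: "monoid_scale scale 1 p = p"
proof (induction p rule: poly_mapping_single_induct)
  case (add g m p)
  then show ?case
    by (simp add: monoid_scale_add_right scale_one flip: single_one)
qed simp

lemma semimodule_monoid_scale:
  "semimodule (monoid_scale scale :: ('g::comm_monoid_add \<Rightarrow>\<^sub>0 's) \<Rightarrow> _)"
  by unfold_locales
    (simp_all add: monoid_scale_add_left monoid_scale_add_right monoid_scale_mult
      monoid_scale_one)

end

end

theory Submission
  imports Defs
begin

text \<open>Let \<open>p \<noteq> 0\<close> have minimal support among the elements annihilated by \<open>f\<close>. If \<open>a + b\<close>, with
  \<open>a\<close> in the support of \<open>f\<close> and \<open>b\<close> in that of \<open>p\<close>, has no other such representation, then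
  \<open>f\<^sub>a p\<^sub>b = 0\<close>, so \<open>f\<^sub>a p\<close> has smaller support than \<open>p\<close> and is still annihilated by \<open>f\<close>; hence
  \<open>f\<^sub>a p = 0\<close>. The term at \<open>a\<close> can then be dropped from \<open>f\<close> without any subtraction, and repeating
  this gives \<open>f\<^sub>a p = 0\<close> for all \<open>a\<close>: every coefficient of \<open>p\<close> is annihilated by \<open>f\<close>.

  Instead of ordering \<open>G\<close>, the unique sum \<open>a + b\<close> is taken to be a point \<open>c\<close> of the sumset that is
  not the midpoint of two other points: if \<open>c = a + b = a' + b'\<close> then \<open>2c = (a + b') + (a' + b)\<close>.
  Such a point exists because a finite nonempty set in which every point is a convex combination of
  the others could be shrunk to a singleton by eliminating one point after the other.\<close>

text \<open>The sum has the form used in the axiom \<open>torsion_free\<close>, which therefore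
  applies after unfolding.\<close>

definition nat_scale :: "nat \<Rightarrow> 'a::comm_monoid_add \<Rightarrow> 'a" where
  "nat_scale n a = (\<Sum>i<n. a)"

lemma nat_scale_0 [simp]: "nat_scale 0 a = 0"
  and nat_scale_Suc [simp]: "nat_scale (Suc n) a = nat_scale n a + a"
  by (simp_all add: nat_scale_def)

lemma nat_scale_add: "nat_scale (m + n) a = nat_scale m a + nat_scale n a"
  by (induction n) (simp_all add: add.assoc)

lemma nat_scale_zero_right [simp]: "nat_scale n 0 = 0"
  by (simp add: nat_scale_def)

lemma nat_scale_add_right: "nat_scale n (a + b) = nat_scale n a + nat_scale n b"
  by (simp add: nat_scale_def sum.distrib)

lemma nat_scale_mult: "nat_scale (m * n) a = nat_scale m (nat_scale n a)"
  by (induction m) (simp_all add: nat_scale_add add.commute)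

lemma nat_scale_sum: "nat_scale n (\<Sum>x\<in>A. h x) = (\<Sum>x\<in>A. nat_scale n (h x))"
  by (simp add: nat_scale_def sum.swap[of _ _ A])

text \<open>Substituting the combination for \<open>e\<close> into all the others yields the same
  hypothesis for the smaller set. Clearing denominators turns rational convex weights into natural
  weights \<open>m\<close> with total \<open>sum m C\<close>, which make sense in any commutative
  monoid.\<close>

lemma no_mutual_convex_combinations:
  fixes C :: "'g::{torsion_free_comm_monoid_add, cancel_semigroup_add} set"
  assumes "finite C" "C \<noteq> {}"
    and "\<And>c. c \<in> C \<Longrightarrow> \<exists>m. m c = 0 \<and> sum m C > 0 \<and>
      nat_scale (sum m C) c = (\<Sum>d\<in>C. nat_scale (m d) d)"
  shows False
  using assms
proof (induction C rule: finite_induct)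
  case (insert e C)
  obtain q where "q e = 0" and q: "sum q C > 0"
    "nat_scale (sum q C) e = (\<Sum>d\<in>C. nat_scale (q d) d)"
    using insert.prems(2)[of e] insert.hyps by auto
  have "\<exists>m. m c = 0 \<and> sum m C > 0 \<and>
      nat_scale (sum m C) c = (\<Sum>d\<in>C. nat_scale (m d) d)" if c: "c \<in> C" for c
  proof -
    obtain p where p: "p c = 0" "p e + sum p C > 0"
      "nat_scale (p e + sum p C) c = nat_scale (p e) e + (\<Sum>d\<in>C. nat_scale (p d) d)"
      using insert.prems(2)[of c] insert.hyps c by auto
    \<comment> \<open>These are the weights after multiplying the equation for \<open>c\<close> by
      \<open>sum q C\<close> and replacing \<open>e\<close>. They may put weight
      \<open>p e * q c\<close> on \<open>c\<close> itself; \<open>m\<close> drops it, and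
      cancellation in the monoid justifies this.\<close>
    define r where "r d = sum q C * p d + p e * q d" for d
    define m where "m = r(c := 0)"
    have rc: "r c = p e * q c" by (simp add: r_def p)
    have sum_m: "sum m C + p e * q c = sum q C * (p e + sum p C)"
    proof -
      have "sum m C + p e * q c = sum r C"
        using sum.remove[OF insert.hyps(1) c, of m] sum.remove[OF insert.hyps(1) c, of r]
        by (simp add: m_def rc)
      also have "\<dots> = sum q C * (p e + sum p C)"
        by (simp add: r_def sum.distrib flip: sum_distrib_left) (simp add: algebra_simps)
      finally show ?thesis .
    qed
    have "nat_scale (sum m C) c + nat_scale (p e * q c) c = nat_scale (sum q C * (p e + sum p C)) c"
      by (simp add: sum_m flip: nat_scale_add)
    also have "\<dots> = nat_scale (p e) (nat_scale (sum q C) e)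
        + (\<Sum>d\<in>C. nat_scale (sum q C * p d) d)"
      unfolding nat_scale_mult p nat_scale_add_right nat_scale_sum
      by (simp only: mult.commute flip: nat_scale_mult)
    also have "\<dots> = (\<Sum>d\<in>C. nat_scale (r d) d)"
      by (simp add: q r_def nat_scale_sum nat_scale_add nat_scale_mult sum.distrib add.commute)
    also have "\<dots> = (\<Sum>d\<in>C. nat_scale (m d) d) + nat_scale (p e * q c) c"
      using sum.remove[OF insert.hyps(1) c, of "\<lambda>d. nat_scale (m d) d"]
        sum.remove[OF insert.hyps(1) c, of "\<lambda>d. nat_scale (r d) d"]
      by (simp add: m_def rc add.commute)
    finally have eq: "nat_scale (sum m C) c = (\<Sum>d\<in>C. nat_scale (m d) d)"
      by (metis add.commute add_left_imp_eq)
    \<comment> \<open>Total weight 0 would force the combination for \<open>e\<close> to be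
      concentrated at \<open>c\<close>; torsion-freeness then gives \<open>e = c\<close>.\<close>
    have "sum m C \<noteq> 0"
    proof
      assume "sum m C = 0"
      with sum_m have "sum q C * (p e + sum p C) = q c * p e" by (simp add: mult.commute)
      also have "\<dots> \<le> q c * (p e + sum p C)" by simp
      finally have "sum q C \<le> q c" using p(2) by (simp only: mult_le_cancel2)
      then have rest: "sum q (C - {c}) = 0" and qc: "sum q C = q c"
        using c insert.hyps(1) by (simp_all add: sum.remove[of C c q])
      then have "(\<Sum>d\<in>C - {c}. nat_scale (q d) d) = 0"
        using insert.hyps(1) by (intro sum.neutral) auto
      then have "nat_scale (q c) e = nat_scale (q c) c"
        using q(2) c insert.hyps(1) qc by (simp add: sum.remove[of C c "\<lambda>d. nat_scale (q d) d"])
      then have "e = c"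
        using q(1) qc torsion_free[of "q c" e c] by (simp add: nat_scale_def)
      with c insert.hyps show False by simp
    qed
    with eq show ?thesis by (intro exI[of _ m]) (simp add: m_def)
  qed
  moreover have "C \<noteq> {}" using q(1) by auto
  ultimately show False using insert.IH by blast
qed simp

lemma exists_non_midpoint:
  fixes C :: "'g::{torsion_free_comm_monoid_add, cancel_semigroup_add} set"
  assumes "finite C" "C \<noteq> {}"
  obtains c where "c \<in> C" "\<And>x y. x \<in> C \<Longrightarrow> y \<in> C \<Longrightarrow> x + y = c + c \<Longrightarrow> x = c"
proof (rule ccontr)
  assume "\<not> thesis"
  with that have mid: "\<exists>x\<in>C. \<exists>y\<in>C. x + y = c + c \<and> x \<noteq> c" if "c \<in> C" for c
    using \<open>c \<in> C\<close> by blast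
  show False
  proof (rule no_mutual_convex_combinations[OF assms])
    fix c assume "c \<in> C"
    from mid[OF this] obtain x y where xy: "x \<in> C" "y \<in> C" "x + y = c + c" "x \<noteq> c" by blast
    then have "y \<noteq> c" by (metis add.commute add_left_imp_eq)
    \<comment> \<open>The indicators are added, so that the total weight is 2 even if
      \<open>x = y\<close>.\<close>
    define m where "m d = (if d = x then 1 else 0) + (if d = y then 1 else 0 :: nat)" for d
    have "sum m C = 2"
      using xy assms by (simp add: m_def sum.distrib)
    moreover have "(\<Sum>d\<in>C. nat_scale (m d) d) = x + y"
    proof -
      have "nat_scale (m d) d = (if d = x then d else 0) + (if d = y then d else 0)" for d
        by (simp add: m_def)
      then show ?thesis using xy assms by (simp add: sum.distrib)
    qed
    ultimately show "\<exists>m. m c = 0 \<and> sum m C > 0 \<and>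
        nat_scale (sum m C) c = (\<Sum>d\<in>C. nat_scale (m d) d)"
      using xy \<open>y \<noteq> c\<close> by (intro exI[of _ m]) (simp add: m_def numeral_2_eq_2)
  qed
qed

lemma exists_unique_sum:
  fixes A B :: "'g::{torsion_free_comm_monoid_add, cancel_semigroup_add} set"
  assumes "finite A" "A \<noteq> {}" "finite B" "B \<noteq> {}"
  obtains a b where "a \<in> A" "b \<in> B"
    "\<And>a' b'. a' \<in> A \<Longrightarrow> b' \<in> B \<Longrightarrow> a' + b' = a + b \<Longrightarrow> a' = a \<and> b' = b"
proof -
  define C where "C = (\<lambda>(a, b). a + b) ` (A \<times> B)"
  have "finite C" "C \<noteq> {}" using assms by (auto simp: C_def)
  then obtain c where c: "c \<in> C" "\<And>x y. x \<in> C \<Longrightarrow> y \<in> C \<Longrightarrow> x + y = c + c \<Longrightarrow> x = c"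
    using exists_non_midpoint[of C] by metis
  from c(1) obtain a b where ab: "a \<in> A" "b \<in> B" "c = a + b" by (auto simp: C_def)
  show thesis
  proof (rule that[OF ab(1,2)])
    fix a' b' assume a'b': "a' \<in> A" "b' \<in> B" "a' + b' = a + b"
    have "(a + b') + (a' + b) = (a + b) + (a' + b')" by (simp add: ac_simps)
    then have "a + b' = c" using a'b' ab by (intro c(2)) (auto simp: C_def)
    then have "b' = b" using ab(3) by (simp add: add_left_imp_eq)
    with a'b'(3) show "a' = a \<and> b' = b" by (metis add.commute add_left_imp_eq)
  qed
qed

context semimodule
begin

text \<open>Uniqueness leaves a single term of the double sum at the exponent
  \<open>a + b\<close>.\<close>

lemma lookup_monoid_scale_unique_sum:
  assumes "a \<in> Poly_Mapping.keys f" "b \<in> Poly_Mapping.keys p"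
    and "\<And>a' b'. a' \<in> Poly_Mapping.keys f \<Longrightarrow> b' \<in> Poly_Mapping.keys p \<Longrightarrow>
      a' + b' = a + b \<Longrightarrow> a' = a \<and> b' = b"
  shows "Poly_Mapping.lookup (monoid_scale scale f p) (a + b) =
    scale (Poly_Mapping.lookup f a) (Poly_Mapping.lookup p b)"
proof -
  have "Poly_Mapping.lookup (monoid_scale scale f p) (a + b) =
    (\<Sum>g\<in>Poly_Mapping.keys f. \<Sum>h\<in>Poly_Mapping.keys p. if g = a then if h = b then
        scale (Poly_Mapping.lookup f g) (Poly_Mapping.lookup p h) else 0 else 0)"
    unfolding monoid_scale_def lookup_sum
    by (intro sum.cong refl) (use assms(3) in \<open>auto simp: lookup_single when_def\<close>)
  also have "\<dots> = (\<Sum>g\<in>Poly_Mapping.keys f. if g = a then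
      scale (Poly_Mapping.lookup f g) (Poly_Mapping.lookup p b) else 0)"
    using assms(2) by (intro sum.cong refl) simp
  also have "\<dots> = scale (Poly_Mapping.lookup f a) (Poly_Mapping.lookup p b)"
    using assms(1) by simp
  finally show ?thesis .
qed

lemma lookup_monoid_scale_single_0:
  "Poly_Mapping.lookup (monoid_scale scale (Poly_Mapping.single 0 s) p) h =
    scale s (Poly_Mapping.lookup p h)"
  by (induction p rule: poly_mapping_single_induct)
    (simp_all add: monoid_scale_add_right lookup_add lookup_single when_def scale_add_right
      scale_zero_right)

text \<open>Induction on the number of terms of \<open>f\<close>, deleting one at a time. The
  assumption \<open>minimal\<close> speaks of \<open>p\<close> and its constant multiples but not of
  \<open>f\<close>, so it stays available when \<open>f\<close> loses a term.\<close>

lemma coeffs_annihilate: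
  fixes f :: "'g::{torsion_free_comm_monoid_add, cancel_semigroup_add} \<Rightarrow>\<^sub>0 's"
    and p :: "'g \<Rightarrow>\<^sub>0 'm"
  assumes "p \<noteq> 0"
    and minimal: "\<And>s. Poly_Mapping.keys (monoid_scale scale (Poly_Mapping.single 0 s) p)
      \<subset> Poly_Mapping.keys p \<Longrightarrow> monoid_scale scale (Poly_Mapping.single 0 s) p = 0"
    and "monoid_scale scale f p = 0"
  shows "monoid_scale scale (Poly_Mapping.single 0 (Poly_Mapping.lookup f x)) p = 0"
  using assms(3)
proof (induction "card (Poly_Mapping.keys f)" arbitrary: f rule: less_induct)
  case less
  show ?case
  proof (cases "f = 0")
    case False
    obtain a b where a: "a \<in> Poly_Mapping.keys f" and b: "b \<in> Poly_Mapping.keys p"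
      and "\<And>a' b'. a' \<in> Poly_Mapping.keys f \<Longrightarrow> b' \<in> Poly_Mapping.keys p \<Longrightarrow>
        a' + b' = a + b \<Longrightarrow> a' = a \<and> b' = b"
      using exists_unique_sum[of "Poly_Mapping.keys f" "Poly_Mapping.keys p"] False assms(1)
      by (metis finite_keys keys_eq_empty)
    note lookup_ab = lookup_monoid_scale_unique_sum[OF this]
    define s where "s = Poly_Mapping.lookup f a"
    have "scale s (Poly_Mapping.lookup p b) = 0"
      by (simp add: s_def less.prems flip: lookup_ab)
    \<comment> \<open>The support cannot grow, since scalars send 0 to 0, and it loses
      \<open>b\<close>.\<close>
    then have "Poly_Mapping.keys (monoid_scale scale (Poly_Mapping.single 0 s) p)
        \<subset> Poly_Mapping.keys p"
      using b unfolding psubset_eq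
      by (auto simp: lookup_monoid_scale_single_0 scale_zero_right in_keys_iff set_eq_iff)
    then have s: "monoid_scale scale (Poly_Mapping.single 0 s) p = 0"
      by (rule minimal)
    define f' where "f' = Poly_Mapping.update a 0 f"
    have f: "f = Poly_Mapping.single a s + f'"
      by (rule poly_mapping_eqI)
        (auto simp: f'_def s_def lookup_add lookup_single lookup_update when_def)
    \<comment> \<open>Shifting exponents preserves 0:
      \<open>(s X^a) p = X^a (s p) = 0\<close>.\<close>
    have "monoid_scale scale (Poly_Mapping.single a s) p =
        monoid_scale scale (Poly_Mapping.single a 1 * Poly_Mapping.single 0 s) p"
      by (simp add: mult_single)
    also have "\<dots> = 0" by (simp only: monoid_scale_mult s monoid_scale_zero)
    finally have "monoid_scale scale f' p = 0"
      using less.prems by (subst (asm) f) (simp add: monoid_scale_add_left)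
    moreover have "Poly_Mapping.keys f' = Poly_Mapping.keys f - {a}"
      by (simp add: f'_def keys_update)
    then have "card (Poly_Mapping.keys f') < card (Poly_Mapping.keys f)"
      using a by (simp only: card_Diff1_less finite_keys)
    ultimately have "monoid_scale scale (Poly_Mapping.single 0 (Poly_Mapping.lookup f' x)) p = 0"
      using less.hyps by blast
    then show ?thesis
      using s by (cases "x = a") (simp_all add: s_def f'_def lookup_update)
  qed simp
qed

end

theorem theorem2p1:
  fixes scale :: "'s::comm_semiring_1 \<Rightarrow> 'm::comm_monoid_add \<Rightarrow> 'm"
    and f :: "'g::{torsion_free_comm_monoid_add, cancel_semigroup_add} \<Rightarrow>\<^sub>0 's"
  assumes "semimodule scale"
    and "zero_divisor_on (monoid_scale scale) f"
  shows "\<exists>b. b \<noteq> 0 \<and> monoid_scale scale f (const_poly b) = 0"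
proof -
  interpret semimodule scale by fact
  obtain p where p: "p \<noteq> 0" "monoid_scale scale f p = 0"
    and min: "\<And>q. q \<noteq> 0 \<and> monoid_scale scale f q = 0 \<Longrightarrow>
      card (Poly_Mapping.keys p) \<le> card (Poly_Mapping.keys q)"
    using ex_has_least_nat[of "\<lambda>q. q \<noteq> 0 \<and> monoid_scale scale f q = 0" _
        "\<lambda>q. card (Poly_Mapping.keys q)"] assms(2)
    by (auto simp: zero_divisor_on_def)
  have coeffs: "monoid_scale scale (Poly_Mapping.single 0 (Poly_Mapping.lookup f x)) p = 0" for x
  proof (rule coeffs_annihilate[OF p(1) _ p(2)])
    fix s
    let ?q = "monoid_scale scale (Poly_Mapping.single 0 s) p"
    assume "Poly_Mapping.keys ?q \<subset> Poly_Mapping.keys p"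
    then have "card (Poly_Mapping.keys ?q) < card (Poly_Mapping.keys p)"
      by (simp add: psubset_card_mono)
    \<comment> \<open>Multiplication in \<open>S[G]\<close> is commutative, so
      \<open>f (s p) = s (f p) = 0\<close>.\<close>
    moreover have "monoid_scale scale f ?q = 0"
      using p(2) by (simp flip: monoid_scale_mult add: mult.commute[of f]) (simp add: monoid_scale_mult)
    ultimately show "?q = 0" using min[of ?q] by force
  qed
  \<comment> \<open>Any nonzero coefficient of \<open>p\<close> serves as the constant.\<close>
  from p(1) obtain h where h: "Poly_Mapping.lookup p h \<noteq> 0"
    by (metis poly_mapping_eqI lookup_zero)
  have "scale (Poly_Mapping.lookup f x) (Poly_Mapping.lookup p h) = 0" for x
    using lookup_monoid_scale_single_0[of "Poly_Mapping.lookup f x" p h] by (simp add: coeffs)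
  then have "monoid_scale scale f (const_poly (Poly_Mapping.lookup p h)) = 0"
    using h by (simp add: monoid_scale_def const_poly_def)
  with h show ?thesis by blast
qed

end
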